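(* For $\alpha\in(0,1]$ let $\xi=(\xi_k)_{k\ge 0}$ be a collection of independent Poisson point processes on $[0,1]$, each with intensity $\alpha$, and let $U$ be the number of leaves (vertices with no children) of the bump tree $\gamma(\xi)$. Write $\mathbf{E}_\alpha$ for the corresponding expectation. Then for $0<\alpha<1$, $$\mathbf{E}_\alpha[U]=\frac{e^{-\alpha}}{1-\alpha},$$ and $\mathbf{E}_1[U]$ diverges, i.e. $\mathbf{E}_1[U]=+\infty$.
   Context: A point process on $[0,1]$ is an integer-valued measure on the Borel sets of $[0,1]$, viewed as a collection of points (its atoms). A Poisson point process on $[0,1]$ with intensity $\alpha$ is a random such measure for which the number of atoms in a Borel set $E$ of Lebesgue measure $\lambda$ is Poisson with mean $\alpha\lambda$, and the numbers of atoms in disjoint Borel sets are independent. A point process configuration is a sequence $\xi=(\xi_k)_{k\ge0}$ of point processes on $[0,1]$. For an atom $x\in\xi_0$, the bump map is $f(\xi,x)=(\xi'_k)_{k\ge0}$, where $\xi'_k=\xi_{k+1}|_{[0,x)}+\xi_k|_{(x,1]}$ (the atoms of $\xi_{k+1}$ in $[0,x)$ together with the atoms of $\xi_k$ in $(x,1]$). The bump tree $\gamma(\xi)$ is the rooted tree defined recursively, each vertex $v$ carrying a configuration $\xi^v$: the root $v_0$ carries $\xi^{v_0}=\xi$; a vertex $v$ has exactly one child $v(x)$ for each atom $x\in\xi^v_0$, and this child carries $\xi^{v(x)}=f(\xi^v,x)$. (Almost surely all atoms of $\xi$ are at distinct locations.) The root counts as a leaf if it has no children. *)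

theory Defs
  imports "HOL-Probability.Probability"
begin

abbreviation unit_borel :: "real measure" where
  "unit_borel \<equiv> restrict_space borel {0..1}"

text \<open>Integer-valued is read as finite: the value \<open>\<infinity>\<close> is excluded.\<close>

definition point_measure :: "real measure \<Rightarrow> bool" where
  "point_measure \<mu> \<longleftrightarrow>
     sets \<mu> = sets unit_borel \<and> (\<forall>E\<in>sets \<mu>. \<exists>n::nat. emeasure \<mu> E = of_nat n)"

text \<open>
  The space of point measures carries the coarsest sigma-algebra that makes all evaluations
  \<open>\<mu> \<mapsto> \<mu> E\<close> measurable, in analogy with \<^const>\<open>subprob_algebra\<close>.
\<close>

definition point_algebra :: "real measure measure" where
  "point_algebra =
     (SUP E\<in>sets unit_borel. vimage_algebra {\<mu>. point_measure \<mu>} (\<lambda>\<mu>. emeasure \<mu> E) borel)"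

definition atoms :: "real measure \<Rightarrow> real set" where
  "atoms \<mu> = {x \<in> space \<mu>. emeasure \<mu> {x} \<noteq> 0}"

text \<open>
  The Poisson weights are written out because \<^const>\<open>poisson_pmf\<close> is only specified for
  positive rates, whereas \<open>E\<close> may be a null set. Padding with empty sets shows that the
  independence condition on sequences covers finite families of disjoint sets.
\<close>

definition (in prob_space) poisson_point_process :: "real \<Rightarrow> ('a \<Rightarrow> real measure) \<Rightarrow> bool" where
  "poisson_point_process \<alpha> X \<longleftrightarrow>
     random_variable point_algebra X \<and>
     (\<forall>E\<in>sets unit_borel. \<forall>n::nat.
        prob {\<omega>\<in>space M. emeasure (X \<omega>) E = of_nat n} =
          (\<alpha> * measure lborel E) ^ n / fact n * exp (- (\<alpha> * measure lborel E))) \<and>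
     (\<forall>E::nat \<Rightarrow> real set. range E \<subseteq> sets unit_borel \<longrightarrow> disjoint_family E \<longrightarrow>
        indep_vars (\<lambda>_. borel) (\<lambda>i \<omega>. emeasure (X \<omega>) (E i)) UNIV)"

type_synonym configuration = "nat \<Rightarrow> real measure"

definition bump :: "configuration \<Rightarrow> real \<Rightarrow> configuration" where
  "bump \<xi> x = (\<lambda>k. measure_of {0..1} (sets unit_borel)
     (\<lambda>E. emeasure (\<xi> (Suc k)) (E \<inter> {0..<x}) + emeasure (\<xi> k) (E \<inter> {x<..1})))"

text \<open>
  A vertex of the bump tree is encoded as the list of atoms chosen along the path from the
  root, so the root is \<open>[]\<close> and the children of \<open>v\<close> have the form \<open>v @ [x]\<close>.
\<close>

definition config_at :: "configuration \<Rightarrow> real list \<Rightarrow> configuration" where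
  "config_at \<xi> v = foldl bump \<xi> v"

definition children :: "configuration \<Rightarrow> real list \<Rightarrow> real list set" where
  "children \<xi> v = {v @ [x] | x. x \<in> atoms (config_at \<xi> v 0)}"

inductive_set bump_tree :: "configuration \<Rightarrow> real list set" for \<xi> :: configuration where
  root: "[] \<in> bump_tree \<xi>"
| child: "v \<in> bump_tree \<xi> \<Longrightarrow> w \<in> children \<xi> v \<Longrightarrow> w \<in> bump_tree \<xi>"

definition leaves :: "configuration \<Rightarrow> real list set" where
  "leaves \<xi> = {v \<in> bump_tree \<xi>. children \<xi> v = {}}"

definition num_leaves :: "configuration \<Rightarrow> ennreal" where
  "num_leaves \<xi> = emeasure (count_space UNIV) (leaves \<xi>)"

lemma emeasure_bump:
  assumes "\<And>k. point_measure (\<xi> k)" and "E \<in> sets unit_borel"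
  shows "emeasure (bump \<xi> x k) E =
    emeasure (\<xi> (Suc k)) (E \<inter> {0..<x}) + emeasure (\<xi> k) (E \<inter> {x<..1})"
proof -
  have S: "sets (\<xi> j) = sets unit_borel" for j
    using assms(1) by (simp add: point_measure_def)
  have I: "F \<inter> {0..<x} \<in> sets (\<xi> j)" "F \<inter> {x<..1} \<in> sets (\<xi> j)" if "F \<in> sets unit_borel" for F j
    using that unfolding S by (auto simp: sets_restrict_space_iff)
  have sp: "space unit_borel = {0..1}" by (simp add: space_restrict_space)
  let ?m = "\<lambda>F. emeasure (\<xi> (Suc k)) (F \<inter> {0..<x}) + emeasure (\<xi> k) (F \<inter> {x<..1})"
  have "countably_additive (sets unit_borel) ?m"
  proof (rule countably_additiveI)
    fix A :: "nat \<Rightarrow> real set"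
    assume A: "range A \<subseteq> sets unit_borel" "disjoint_family A"
    have d: "disjoint_family (\<lambda>i. A i \<inter> C)" for C
      using A(2) by (auto simp: disjoint_family_on_def)
    have "(\<Sum>i. ?m (A i)) = (\<Sum>i. emeasure (\<xi> (Suc k)) (A i \<inter> {0..<x})) +
        (\<Sum>i. emeasure (\<xi> k) (A i \<inter> {x<..1}))"
      by (simp add: suminf_add)
    also have "\<dots> = emeasure (\<xi> (Suc k)) (\<Union>i. A i \<inter> {0..<x}) +
        emeasure (\<xi> k) (\<Union>i. A i \<inter> {x<..1})"
      using A(1) I d by (subst (1 2) suminf_emeasure) auto
    finally show "(\<Sum>i. ?m (A i)) = ?m (\<Union> (range A))" by simp
  qed
  then show ?thesis
    unfolding bump_def
    by (intro emeasure_measure_of_sigma)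
      (use assms(2) sp sets.sigma_algebra_axioms[of unit_borel] in
        \<open>auto simp: positive_def\<close>)
qed

lemma point_measure_bump:
  assumes "\<And>k. point_measure (\<xi> k)"
  shows "point_measure (bump \<xi> x k)"
proof -
  have sp: "space unit_borel = {0..1}" by (simp add: space_restrict_space)
  have S: "sets (bump \<xi> x k) = sets unit_borel"
    unfolding bump_def using sets.sigma_sets_eq[of unit_borel] sets.space_closed[of unit_borel]
    by (simp add: sp)
  have "\<exists>n::nat. emeasure (bump \<xi> x k) E = of_nat n" if E: "E \<in> sets unit_borel" for E
  proof -
    have "E \<inter> {0..<x} \<in> sets unit_borel" "E \<inter> {x<..1} \<in> sets unit_borel"
      using E by (auto simp: sets_restrict_space_iff)
    then obtain m n :: nat where "emeasure (\<xi> (Suc k)) (E \<inter> {0..<x}) = of_nat m"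
      "emeasure (\<xi> k) (E \<inter> {x<..1}) = of_nat n"
      using assms unfolding point_measure_def by metis
    then have "emeasure (bump \<xi> x k) E = of_nat (m + n)"
      using emeasure_bump[OF assms E] by simp
    then show ?thesis ..
  qed
  with S show ?thesis by (simp add: point_measure_def)
qed

end

theory Submission
  imports Defs
begin

text \<open>
  After bumping at the points of a vertex \<open>v\<close>, the configuration shows near \<open>y \<notin> set v\<close> the process
  whose index is the number of points of \<open>v\<close> above \<open>y\<close>, and nothing at the points of \<open>v\<close>. Hence
  membership of each point in a leaf is decided by looking at that point in a single process. Cut
  \<open>[0,1]\<close> into \<open>N\<close> cells and apply the same rule to the sets of occupied cells: once \<open>N\<close> separates
  the finitely many relevant atoms, this gives the correct number of leaves of depth \<open>n\<close>. By
  independence each of the roughly \<open>N ^ n\<close> lists of \<open>n\<close> distinct cells is a discrete leaf with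
  probability about \<open>(\<alpha> / N) ^ n * exp (- \<alpha>)\<close>, since every cell is tested in exactly one process.
  So the expected number of leaves of depth \<open>n\<close> is at most \<open>\<alpha> ^ n * exp (- \<alpha>)\<close> by Fatou's lemma;
  counting only the discrete leaves whose cells contain a single atom in all processes up to \<open>n\<close>
  gives the matching lower bound. It remains to sum the geometric series.
\<close>

section \<open>Leaves as lists of points\<close>

text \<open>
  If \<open>y\<close> occurs in \<open>v\<close>, only the entries before \<open>y\<close> count: \<open>level v y\<close> is then the index of the
  process from which \<open>y\<close> was chosen.
\<close>

definition level :: "'a::linorder list \<Rightarrow> 'a \<Rightarrow> nat" where
  "level v y = length (filter (\<lambda>x. y < x) (takeWhile (\<lambda>x. x \<noteq> y) v))"

text \<open>
  For \<open>S k\<close> the atoms of the \<open>k\<close>-th process, these are the leaves of depth \<open>n\<close>: the implication from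
  left to right says that \<open>v\<close> is a vertex, the converse that it has no children. Polymorphism allows
  the same notion for cells in place of points.
\<close>

definition ends :: "(nat \<Rightarrow> 'a::linorder set) \<Rightarrow> nat \<Rightarrow> 'a list set" where
  "ends S n = {v. distinct v \<and> length v = n \<and> (\<forall>y. y \<in> set v \<longleftrightarrow> y \<in> S (level v y))}"

lemma level_le_length: "level v y \<le> length v"
  unfolding level_def by (meson length_filter_le length_takeWhile_le le_trans)

lemma level_append_in: "y \<in> set v \<Longrightarrow> level (v @ w) y = level v y"
  by (simp add: level_def)

text \<open>A bump at \<open>x\<close> pulls up the next process on \<open>[0,x)\<close> only, so
  exactly the points below \<open>x\<close> have their index raised.\<close>

lemma level_snoc_notin:
  assumes "y \<notin> set v"
  shows "level (v @ [x]) y = level v y + (if y < x then 1 else 0)"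
proof -
  have 1: "takeWhile (\<lambda>z. z \<noteq> y) v = v"
    unfolding takeWhile_eq_all_conv using assms by blast
  have 2: "takeWhile (\<lambda>z. z \<noteq> y) (v @ [x]) = v @ takeWhile (\<lambda>z. z \<noteq> y) [x]"
    by (rule takeWhile_append2) (use assms in blast)
  have 3: "length (filter (\<lambda>z. y < z) (takeWhile (\<lambda>z. z \<noteq> y) [x])) = (if y < x then 1 else 0)"
    by (cases "x = y") simp_all
  show ?thesis
    unfolding level_def 1 2 filter_append length_append 3 ..
qed

text \<open>A level depends only on comparisons with entries of \<open>v\<close>, and a monotone map
  preserves these unless it merges \<open>y\<close> with a different entry.\<close>

lemma level_map:
  assumes "mono \<phi>" and "\<And>x. x \<in> set v \<Longrightarrow> \<phi> x = \<phi> y \<Longrightarrow> x = y"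
  shows "level (map \<phi> v) (\<phi> y) = level v y"
  using assms(2)
proof (induction v)
  case (Cons a v)
  then have "\<phi> y < \<phi> a \<longleftrightarrow> y < a"
    using mono_strict_invE[OF \<open>mono \<phi>\<close>, of y a] monoD[OF \<open>mono \<phi>\<close>, of y a] Cons.prems[of a]
    by (metis list.set_intros(1) order_less_le)
  moreover have "\<phi> a = \<phi> y \<longleftrightarrow> a = y" using Cons.prems by auto
  moreover have "level (map \<phi> v) (\<phi> y) = level v y" using Cons by simp
  ultimately show ?case by (simp add: level_def)
qed (simp add: level_def)

text \<open>Levels are bounded by the length, so at depth \<open>n\<close> only the processes with
  index at most \<open>n\<close> matter.\<close>

lemma ends_subset: "v \<in> ends S n \<Longrightarrow> set v \<subseteq> (\<Union>k\<le>n. S k)"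
proof
  fix y assume v: "v \<in> ends S n" and y: "y \<in> set v"
  then have "y \<in> S (level v y)" "level v y \<le> n"
    using level_le_length[of v y] by (auto simp: ends_def)
  then show "y \<in> (\<Union>k\<le>n. S k)" by blast
qed

text \<open>Injectivity is imposed on all points up to index \<open>n\<close>, so that points
  outside \<open>v\<close> keep their levels too and testing their cells gives the same answer as
  testing the points.\<close>

lemma map_in_ends:
  assumes "mono \<phi>" and inj: "inj_on \<phi> (\<Union>k\<le>n. S k)" and v: "v \<in> ends S n"
  shows "map \<phi> v \<in> ends (\<lambda>k. \<phi> ` S k) n"
proof -
  let ?A = "\<Union>k\<le>n. S k"
  have A: "set v \<subseteq> ?A" using v by (rule ends_subset)
  have lev: "level (map \<phi> v) (\<phi> y) = level v y" if "y \<in> ?A" for y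
    using A inj that by (intro level_map[OF \<open>mono \<phi>\<close>]) (auto dest: inj_onD)
  have "j \<in> set (map \<phi> v) \<longleftrightarrow> j \<in> \<phi> ` S (level (map \<phi> v) j)" for j
  proof
    assume "j \<in> set (map \<phi> v)"
    then obtain y where "j = \<phi> y" "y \<in> set v" by auto
    moreover from this A have "level (map \<phi> v) j = level v y" using lev[of y] by blast
    ultimately show "j \<in> \<phi> ` S (level (map \<phi> v) j)"
      using v by (auto simp: ends_def)
  next
    assume "j \<in> \<phi> ` S (level (map \<phi> v) j)"
    then obtain y where y: "j = \<phi> y" "y \<in> S (level (map \<phi> v) j)" by auto
    have "level (map \<phi> v) j \<le> n"
      using level_le_length[of "map \<phi> v" j] v by (simp add: ends_def)
    with y have "y \<in> ?A" by auto
    from lev[OF this] y v show "j \<in> set (map \<phi> v)"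
      by (auto simp: ends_def)
  qed
  moreover have "distinct (map \<phi> v)"
    using A inj v by (auto simp: ends_def distinct_map inj_on_subset)
  ultimately show ?thesis using v by (simp add: ends_def)
qed

text \<open>Each cell of \<open>J\<close> is replaced by a point that the process of its level has
  there. Uniqueness of points is demanded only in the cells of \<open>J\<close>, which is all that
  the lower bound can provide.\<close>

lemma ends_lift:
  assumes "mono \<phi>" and J: "J \<in> ends (\<lambda>k. \<phi> ` S k) n"
    and single: "\<And>x y. \<lbrakk>x \<in> (\<Union>k\<le>n. S k); y \<in> (\<Union>k\<le>n. S k); \<phi> x \<in> set J; \<phi> x = \<phi> y\<rbrakk> \<Longrightarrow> x = y"
  shows "J \<in> map \<phi> ` ends S n"
proof -
  let ?A = "\<Union>k\<le>n. S k"
  have "\<forall>j\<in>set J. \<exists>x. x \<in> S (level J j) \<and> \<phi> x = j"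
    using J by (simp add: ends_def image_iff) metis
  then obtain g where g: "g j \<in> S (level J j)" "\<phi> (g j) = j" if "j \<in> set J" for j
    by metis
  have lJ: "level J j \<le> n" for j
    using level_le_length[of J j] J by (simp add: ends_def)
  define v where "v = map g J"
  have J_eq: "map \<phi> v = J"
    using g by (auto simp: v_def intro: map_idI)
  have gA: "g j \<in> ?A" if "j \<in> set J" for j
    using g(1)[OF that] lJ by blast
  have "y \<in> set v \<longleftrightarrow> y \<in> S (level v y)" for y
  proof
    assume "y \<in> set v"
    then obtain j where j: "j \<in> set J" "y = g j" by (auto simp: v_def)
    have "level J (\<phi> y) = level v y"
      unfolding J_eq[symmetric] using j g by (intro level_map[OF \<open>mono \<phi>\<close>]) (auto simp: v_def)
    with j g(1)[of j] g(2)[of j] show "y \<in> S (level v y)" by simp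
  next
    assume y: "y \<in> S (level v y)"
    have "level v y \<le> n"
      using level_le_length[of v y] J by (simp add: v_def ends_def)
    with y have yA: "y \<in> ?A" by auto
    \<comment> \<open>Outside the cells of \<open>J\<close> points may share a cell, but there
      \<open>\<phi> y\<close> differs from the cell of every entry of \<open>v\<close>. The level of
      \<open>y\<close> is then preserved, and its cell would be occupied where \<open>J\<close>
      requires it to be empty.\<close>
    have "\<phi> y \<in> set J"
    proof (rule ccontr)
      assume notin: "\<phi> y \<notin> set J"
      then have "level J (\<phi> y) = level v y"
        unfolding J_eq[symmetric] by (intro level_map[OF \<open>mono \<phi>\<close>]) (metis image_eqI set_map)
      with y J notin show False by (auto simp: ends_def)
    qed
    then have "y = g (\<phi> y)"
      using single[OF yA gA] g by metis
    with \<open>\<phi> y \<in> set J\<close> show "y \<in> set v" by (auto simp: v_def)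
  qed
  moreover have "distinct v"
    using J J_eq by (metis (mono_tags, lifting) distinct_map ends_def mem_Collect_eq)
  moreover have "length v = n" using J by (simp add: ends_def v_def)
  ultimately show ?thesis using J_eq by (auto simp: ends_def)
qed

section \<open>Vertices and leaves of the bump tree in terms of levels\<close>

lemma point_measureD:
  assumes "point_measure \<mu>"
  shows "sets \<mu> = sets unit_borel" "space \<mu> = {0..1}" "finite_measure \<mu>"
proof -
  show s: "sets \<mu> = sets unit_borel" using assms by (simp add: point_measure_def)
  from sets_eq_imp_space_eq[OF s] show "space \<mu> = {0..1}" by (simp add: space_restrict_space)
  show "finite_measure \<mu>"
    by standard (use assms sets.top[of \<mu>] in \<open>fastforce simp: point_measure_def\<close>)
qed

text \<open>Induction over the bumps. The offset \<open>k\<close> is carried along because process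
  \<open>k\<close> after a bump consults process \<open>Suc k\<close> before it; points of
  \<open>v\<close> disappear because both intervals in \<open>bump\<close> leave out
  \<open>x\<close>.\<close>

lemma atoms_config_at:
  assumes "\<And>k. point_measure (\<xi> k)"
  shows "(\<forall>k. point_measure (config_at \<xi> v k)) \<and>
    (\<forall>k. atoms (config_at \<xi> v k) = {y. y \<notin> set v \<and> y \<in> atoms (\<xi> (level v y + k))})"
proof (induction v rule: rev_induct)
  case Nil
  then show ?case using assms by (simp add: config_at_def level_def)
next
  case (snoc x v)
  let ?c = "config_at \<xi> v"
  have c: "config_at \<xi> (v @ [x]) = bump ?c x" by (simp add: config_at_def)
  have pm: "point_measure (?c k)" for k using snoc by blast
  have pmb: "point_measure (bump ?c x k)" for k using pm by (rule point_measure_bump)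
  have "y \<in> atoms (bump ?c x k) \<longleftrightarrow> y \<notin> set (v @ [x]) \<and> y \<in> atoms (\<xi> (level (v @ [x]) y + k))"
    for y k
  proof (cases "y \<in> {0..1}")
    case True
    have "emeasure (bump ?c x k) {y} =
        emeasure (?c (Suc k)) ({y} \<inter> {0..<x}) + emeasure (?c k) ({y} \<inter> {x<..1})"
      using True by (intro emeasure_bump pm) (auto simp: sets_restrict_space_iff)
    moreover have "{y} \<inter> {0..<x} = (if y < x then {y} else {})"
      "{y} \<inter> {x<..1} = (if x < y then {y} else {})" using True by auto
    ultimately have "y \<in> atoms (bump ?c x k) \<longleftrightarrow>
        y < x \<and> y \<in> atoms (?c (Suc k)) \<or> x < y \<and> y \<in> atoms (?c k)"
      using True by (auto simp: atoms_def point_measureD(2)[OF pm] point_measureD(2)[OF pmb])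
    then show ?thesis
      using snoc by (cases "y \<in> set v") (auto simp: level_snoc_notin)
  next
    case False
    then show ?thesis
      by (auto simp: atoms_def point_measureD(2)[OF pmb] point_measureD(2)[OF assms])
  qed
  with pmb show ?case unfolding c by blast
qed

lemma bump_tree_snoc:
  "v @ [x] \<in> bump_tree \<xi> \<longleftrightarrow> v \<in> bump_tree \<xi> \<and> x \<in> atoms (config_at \<xi> v 0)"
  by (subst bump_tree.simps) (auto simp: children_def)

text \<open>Appending a point does not change the levels of earlier entries, so the condition on an
  entry is settled when it is chosen. Distinctness holds because a chosen atom never
  reappears.\<close>

lemma bump_tree_iff:
  assumes "\<And>k. point_measure (\<xi> k)"
  shows "v \<in> bump_tree \<xi> \<longleftrightarrow> distinct v \<and> (\<forall>y\<in>set v. y \<in> atoms (\<xi> (level v y)))"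
proof (induction v rule: rev_induct)
  case (snoc x v)
  have "atoms (config_at \<xi> v 0) = {y. y \<notin> set v \<and> y \<in> atoms (\<xi> (level v y))}"
    using atoms_config_at[of \<xi> v] assms by simp
  then show ?case
    using snoc by (auto simp: bump_tree_snoc level_append_in level_snoc_notin)
qed (simp add: bump_tree.root)

lemma leaves_eq:
  assumes "\<And>k. point_measure (\<xi> k)"
  shows "leaves \<xi> = (\<Union>n. ends (\<lambda>k. atoms (\<xi> k)) n)"
proof -
  have "atoms (config_at \<xi> v 0) = {y. y \<notin> set v \<and> y \<in> atoms (\<xi> (level v y))}" for v
    using atoms_config_at[of \<xi> v] assms by simp
  then show ?thesis
    by (auto simp: leaves_def children_def ends_def bump_tree_iff[OF assms])
qed

lemma num_leaves_eq:
  assumes "\<And>k. point_measure (\<xi> k)"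
  shows "num_leaves \<xi> = (\<Sum>n. emeasure (count_space UNIV) (ends (\<lambda>k. atoms (\<xi> k)) n))"
  unfolding num_leaves_def leaves_eq[OF assms]
  by (intro suminf_emeasure[symmetric]) (auto simp: disjoint_family_on_def ends_def)

lemma finite_ends: "(\<And>k. finite (S k)) \<Longrightarrow> finite (ends S n)"
proof -
  assume "\<And>k. finite (S k)"
  then have "finite {v. set v \<subseteq> (\<Union>k\<le>n. S k) \<and> length v = n}"
    by (intro finite_lists_length_eq) auto
  then show ?thesis
  proof (rule rev_finite_subset)
    show "ends S n \<subseteq> {v. set v \<subseteq> (\<Union>k\<le>n. S k) \<and> length v = n}"
      using ends_subset[of _ S n] by (simp add: ends_def subset_iff)
  qed
qed

section \<open>Cells and atoms\<close>

text \<open>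
  The cells are the intervals \<open>(j / N, (j + 1) / N]\<close>; truncation by \<^const>\<open>nat\<close> puts the point \<open>0\<close>
  into the cell with index \<open>0\<close>.
\<close>

definition cell_index :: "nat \<Rightarrow> real \<Rightarrow> nat" where
  "cell_index N x = nat (\<lceil>x * real N\<rceil> - 1)"

definition cell :: "nat \<Rightarrow> nat \<Rightarrow> real set" where
  "cell N j = {x \<in> {0..1}. cell_index N x = j}"

lemma mono_cell_index: "mono (cell_index N)"
  unfolding cell_index_def
  by (intro monoI nat_mono diff_right_mono ceiling_mono mult_right_mono) auto

lemma cell_index_less:
  assumes "0 < N" "x \<le> 1"
  shows "cell_index N x < N"
proof -
  have "x * real N \<le> real N" using assms by (simp add: mult_left_le_one_le)
  then have "\<lceil>x * real N\<rceil> \<le> int N" by (simp add: ceiling_le_iff)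
  then show ?thesis using assms by (simp add: cell_index_def nat_less_iff)
qed

lemma eventually_cell_index_less:
  assumes "0 \<le> x" "x < y"
  shows "\<forall>\<^sub>F N in sequentially. cell_index N x < cell_index N y"
proof -
  \<comment> \<open>A gap of 2 after scaling absorbs the rounding and makes the index of
    \<open>y\<close> positive, so that truncation by \<open>nat\<close> does no harm.\<close>
  obtain N0 :: nat where N0: "2 / (y - x) < real N0"
    using reals_Archimedean2 by blast
  have "cell_index N x < cell_index N y" if "N0 \<le> N" for N
  proof -
    have "2 / (y - x) < real N" using N0 that by linarith
    then have "x * real N + 2 < y * real N"
      using assms by (simp add: field_simps)
    moreover have "0 \<le> x * real N" using assms by simp
    moreover have "\<lceil>x * real N\<rceil> < \<lceil>y * real N\<rceil>"
      unfolding less_ceiling_iff using calculation by linarith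
    ultimately show ?thesis
      unfolding cell_index_def by (simp add: zless_nat_conj)
  qed
  then show ?thesis by (auto simp: eventually_sequentially)
qed

lemma eventually_inj_on_cell_index:
  assumes "finite A" "A \<subseteq> {0..}"
  shows "\<forall>\<^sub>F N in sequentially. inj_on (cell_index N) A"
proof -
  have "\<forall>\<^sub>F N in sequentially. x \<noteq> y \<longrightarrow> cell_index N x \<noteq> cell_index N y"
    if "x \<in> A" "y \<in> A" for x y
    using that assms(2) eventually_cell_index_less[of x y] eventually_cell_index_less[of y x]
    by (cases x y rule: linorder_cases) (force elim: eventually_mono)+
  then have "\<forall>\<^sub>F N in sequentially. \<forall>x\<in>A. \<forall>y\<in>A. x \<noteq> y \<longrightarrow> cell_index N x \<noteq> cell_index N y"
    using assms(1) by (simp add: eventually_ball_finite_distrib)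
  then show ?thesis
    by (rule eventually_mono) (auto simp: inj_on_def)
qed

lemma cell_eq:
  assumes "j < N"
  shows "cell N j = (if j = 0 then {0..1 / real N} else {real j / real N<..(real j + 1) / real N})"
proof -
  have N: "0 < real N" using assms by simp
  have le: "x * real N \<le> real j + 1 \<Longrightarrow> x \<le> 1" for x
  proof -
    assume "x * real N \<le> real j + 1"
    also have "\<dots> \<le> 1 * real N" using assms by simp
    finally show "x \<le> 1" using N by (simp only: mult_le_cancel_right)
  qed
  have ge: "real j < x * real N \<Longrightarrow> 0 \<le> x" for x
    using N by (metis less_eq_real_def mult_less_cancel_right_pos not_le of_nat_0_le_iff mult_zero_left order_less_le_trans order_le_less_trans)
  show ?thesis
  proof (cases "j = 0")
    case True
    have "cell_index N x = j \<longleftrightarrow> x * real N \<le> 1" for x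
      using True by (auto simp: cell_index_def ceiling_le_iff)
    with True le show ?thesis
      using N by (auto simp: cell_def pos_le_divide_eq)
  next
    case False
    have "cell_index N x = j \<longleftrightarrow> real j < x * real N \<and> x * real N \<le> real j + 1" for x
      using False by (auto simp: cell_index_def) linarith+
    with False le ge show ?thesis
      using N by (auto simp: cell_def pos_le_divide_eq pos_divide_less_eq)
  qed
qed

lemma measure_cell: "j < N \<Longrightarrow> measure lborel (cell N j) = 1 / real N"
  by (simp add: cell_eq field_simps)

lemma sets_cell [measurable]: "cell N j \<in> sets unit_borel"
proof -
  have "cell_index N \<in> borel \<rightarrow>\<^sub>M count_space UNIV"
    unfolding cell_index_def by measurable
  then have "{x \<in> space borel. cell_index N x = j} \<in> sets borel" by measurable
  moreover have "cell N j = {0..1} \<inter> {x \<in> space borel. cell_index N x = j}"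
    by (auto simp: cell_def)
  ultimately show ?thesis by (auto simp: sets_restrict_space)
qed

lemma disjoint_family_cell: "disjoint_family (cell N)"
  by (auto simp: disjoint_family_on_def cell_def)

section \<open>Mass and atoms of an integer-valued measure\<close>

lemma singleton_sets: "point_measure \<mu> \<Longrightarrow> x \<in> {0..1} \<Longrightarrow> {x} \<in> sets \<mu>"
  by (auto simp: point_measureD sets_restrict_space_iff)

text \<open>Integrality leaves a gap between mass 0 and mass 1, so a limit of positive masses stays
  positive.\<close>

lemma one_le_emeasure_iff:
  assumes "point_measure \<mu>" "E \<in> sets \<mu>"
  shows "1 \<le> emeasure \<mu> E \<longleftrightarrow> emeasure \<mu> E \<noteq> 0"
proof -
  obtain n :: nat where n: "emeasure \<mu> E = of_nat n"
    using assms by (auto simp: point_measure_def)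
  show ?thesis by (cases n) (simp_all add: n)
qed

lemma card_atoms_le:
  assumes "point_measure \<mu>" "E \<in> sets \<mu>" "finite F" "F \<subseteq> atoms \<mu> \<inter> E"
  shows "of_nat (card F) \<le> emeasure \<mu> E"
proof -
  have s: "{x} \<in> sets \<mu>" "1 \<le> emeasure \<mu> {x}" if "x \<in> F" for x
  proof -
    have x: "x \<in> {0..1}" "emeasure \<mu> {x} \<noteq> 0"
      using that assms point_measureD(2)[OF assms(1)] by (auto simp: atoms_def)
    then show "{x} \<in> sets \<mu>" using singleton_sets assms by blast
    with x one_le_emeasure_iff[OF assms(1)] show "1 \<le> emeasure \<mu> {x}" by blast
  qed
  have "of_nat (card F) = (\<Sum>x\<in>F. 1::ennreal)" by simp
  also have "\<dots> \<le> (\<Sum>x\<in>F. emeasure \<mu> {x})" using s by (intro sum_mono) auto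
  also have "\<dots> = emeasure \<mu> F"
    using assms(3) s by (intro emeasure_eq_sum_singleton[symmetric]) auto
  also have "\<dots> \<le> emeasure \<mu> E" using assms by (intro emeasure_mono) auto
  finally show ?thesis .
qed

lemma finite_atoms:
  assumes "point_measure \<mu>"
  shows "finite (atoms \<mu>)"
proof (rule ccontr)
  assume "infinite (atoms \<mu>)"
  obtain n :: nat where n: "emeasure \<mu> (space \<mu>) = of_nat n"
    using assms by (auto simp: point_measure_def)
  obtain F where "F \<subseteq> atoms \<mu>" "finite F" "card F = Suc n"
    using infinite_arbitrarily_large[OF \<open>infinite (atoms \<mu>)\<close>] by metis
  then have "of_nat (Suc n) \<le> emeasure \<mu> (space \<mu>)"
    using card_atoms_le[OF assms, of "space \<mu>" F] by (auto simp: atoms_def)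
  then show False unfolding n by (simp only: of_nat_le_iff)
qed

text \<open>
  The distribution function of an integer-valued measure jumps from \<open>0\<close> to at least \<open>1\<close>, and the
  point where it does so is an atom.
\<close>

lemma emeasure_neq_0_iff_atom:
  assumes pm: "point_measure \<mu>" and E: "E \<in> sets \<mu>"
  shows "emeasure \<mu> E \<noteq> 0 \<longleftrightarrow> atoms \<mu> \<inter> E \<noteq> {}"
proof
  assume "atoms \<mu> \<inter> E \<noteq> {}"
  then obtain x where "x \<in> atoms \<mu> \<inter> E" by blast
  then show "emeasure \<mu> E \<noteq> 0"
    using card_atoms_le[OF pm E, of "{x}"] by auto
next
  interpret finite_measure \<mu> using pm by (rule point_measureD)
  assume nz: "emeasure \<mu> E \<noteq> 0"
  have E01: "E \<subseteq> {0..1}" using sets.sets_into_space[OF E] point_measureD(2)[OF pm] by simp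
  have S: "E \<inter> B \<in> sets \<mu>" if "B \<in> sets borel" for B
    using E that unfolding point_measureD(1)[OF pm] by (auto simp: sets_restrict_space_iff)
  define F where "F t = emeasure \<mu> (E \<inter> {..t})" for t
  have ne: "F t \<noteq> 0 \<longleftrightarrow> 1 \<le> F t" for t
    unfolding F_def by (rule one_le_emeasure_iff[OF pm, symmetric]) (auto intro: S)
  have F_mono: "F s \<le> F t" if "s \<le> t" for s t
    unfolding F_def using that by (intro emeasure_mono S) auto
  define T where "T = {t. F t \<noteq> 0}"
  define t where "t = Inf T"
  have "E \<inter> {..1} = E" using E01 by auto
  then have "1 \<in> T" using nz by (simp add: T_def F_def)
  have "0 \<le> s" if "s \<in> T" for s
  proof (rule ccontr)
    assume "\<not> 0 \<le> s"
    then have "E \<inter> {..s} = {}" using E01 by auto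
    with that show False by (simp add: T_def F_def)
  qed
  then have bdd: "bdd_below T" by (rule bdd_belowI)
  have above: "F (t + 1 / Suc n) \<noteq> 0" for n
  proof -
    obtain s where "s \<in> T" "s < t + 1 / Suc n"
      using cInf_lessD[of T "t + 1 / Suc n"] \<open>1 \<in> T\<close> by (auto simp: t_def)
    with F_mono[of s "t + 1 / Suc n"] show ?thesis by (auto simp: T_def)
  qed
  have below: "F (t - 1 / Suc n) = 0" for n
  proof (rule ccontr)
    assume "F (t - 1 / Suc n) \<noteq> 0"
    then have "t \<le> t - 1 / Suc n" unfolding t_def using bdd by (intro cInf_lower) (auto simp: T_def)
    then show False by simp
  qed
  \<comment> \<open>Continuity from above, available because the measure is finite. The masses on
    the right are all at least 1, hence so is their infimum.\<close>
  have "emeasure \<mu> (E \<inter> {..t}) = (INF n. F (t + 1 / Suc n))"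
  proof -
    have "x \<le> t" if "\<And>n. x \<le> t + 1 / Suc n" for x
    proof (rule field_le_epsilon)
      fix e :: real assume "0 < e"
      then obtain n where "1 / Suc n < e" using nat_approx_posE by blast
      with that[of n] show "x \<le> t + e" by linarith
    qed
    then have eq: "E \<inter> {..t} = (\<Inter>n. E \<inter> {..t + 1 / Suc n})"
      by (auto intro: order_trans)
    have "decseq (\<lambda>n. E \<inter> {..t + 1 / Suc n})"
    proof (rule decseq_SucI)
      fix n
      have "1 / real (Suc (Suc n)) \<le> 1 / real (Suc n)" by (simp add: field_simps)
      then show "E \<inter> {..t + 1 / Suc (Suc n)} \<subseteq> E \<inter> {..t + 1 / Suc n}" by auto
    qed
    then show ?thesis
      unfolding F_def eq by (intro INF_emeasure_decseq[symmetric]) (auto intro!: S)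
  qed
  then have "1 \<le> emeasure \<mu> (E \<inter> {..t})"
    using above by (auto intro!: INF_greatest simp: ne)
  also have "\<dots> \<le> emeasure \<mu> ((E \<inter> {..<t}) \<union> (E \<inter> {t}))"
    by (intro emeasure_mono sets.Un S) auto
  also have "\<dots> \<le> emeasure \<mu> (E \<inter> {..<t}) + emeasure \<mu> (E \<inter> {t})"
    by (intro emeasure_subadditive S) auto
  \<comment> \<open>The part strictly left of \<open>t\<close> is exhausted by countably many sets
    of mass 0, so a mass of at least 1 is left for the point \<open>t\<close>.\<close>
  also have "emeasure \<mu> (E \<inter> {..<t}) = 0"
  proof -
    have "\<exists>n. x \<le> t - 1 / Suc n" if "x < t" for x
    proof -
      from that have "0 < t - x" by simp
      then obtain n where "1 / Suc n < t - x" by (rule nat_approx_posE)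
      then show ?thesis by (intro exI[of _ n]) linarith
    qed
    moreover have "x < t" if "x \<le> t - 1 / Suc n" for x n
      using that by (smt (verit) of_nat_0_less_iff zero_less_Suc zero_less_divide_1_iff)
    ultimately have "E \<inter> {..<t} = (\<Union>n. E \<inter> {..t - 1 / Suc n})" by blast
    moreover have "emeasure \<mu> (\<Union>n. E \<inter> {..t - 1 / Suc n}) = 0"
      using below by (intro emeasure_UN_eq_0) (auto intro!: S simp: F_def)
    ultimately show ?thesis by simp
  qed
  finally have "emeasure \<mu> (E \<inter> {t}) \<noteq> 0" by auto
  then have "t \<in> E" "emeasure \<mu> {t} \<noteq> 0" by (cases "t \<in> E"; simp)+
  then show "atoms \<mu> \<inter> E \<noteq> {}"
    using sets.sets_into_space[OF E] by (auto simp: atoms_def)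
qed

text \<open>The link between the two sides: the combinatorics speaks of occupied cells, the Poisson
  law of counts in cells.\<close>

lemma cell_index_atoms_iff:
  assumes "point_measure \<mu>"
  shows "j \<in> cell_index N ` atoms \<mu> \<longleftrightarrow> emeasure \<mu> (cell N j) \<noteq> 0"
proof -
  have "cell N j \<in> sets \<mu>" by (simp add: point_measureD(1)[OF assms] sets_cell)
  then show ?thesis
    unfolding emeasure_neq_0_iff_atom[OF assms \<open>cell N j \<in> sets \<mu>\<close>]
    using point_measureD(2)[OF assms] by (auto simp: cell_def atoms_def)
qed

lemma atoms_cell_unique:
  assumes "point_measure \<mu>" "emeasure \<mu> (cell N j) \<le> 1"
    and "x \<in> atoms \<mu>" "y \<in> atoms \<mu>" "cell_index N x = j" "cell_index N y = j"
  shows "x = y"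
proof (rule ccontr)
  assume "x \<noteq> y"
  have "{x, y} \<subseteq> atoms \<mu> \<inter> cell N j"
    using assms(3-6) point_measureD(2)[OF assms(1)] by (auto simp: cell_def atoms_def)
  then have "of_nat (card {x, y}) \<le> emeasure \<mu> (cell N j)"
    by (intro card_atoms_le) (auto simp: assms(1) point_measureD(1)[OF assms(1)] sets_cell)
  also note assms(2)
  finally have "of_nat (card {x, y}) \<le> (of_nat 1 :: ennreal)" by simp
  then have "card {x, y} \<le> 1" by (simp only: of_nat_le_iff)
  with \<open>x \<noteq> y\<close> show False by simp
qed

lemma space_point_algebra: "space point_algebra = {\<mu>. point_measure \<mu>}"
  by (auto simp: point_algebra_def space_Sup_eq_UN)

lemma measurable_emeasure_point_algebra [measurable]:
  "E \<in> sets unit_borel \<Longrightarrow> (\<lambda>\<mu>. emeasure \<mu> E) \<in> borel_measurable point_algebra"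
  unfolding point_algebra_def
  by (auto intro!: measurable_SUP1 measurable_vimage_algebra1)

text \<open>The candidates for leaves on the grid. The set does not depend on the random
  configuration, so expected numbers become sums over it.\<close>

definition distinct_lists :: "nat \<Rightarrow> nat \<Rightarrow> nat list set" where
  "distinct_lists n N = {J. length J = n \<and> distinct J \<and> set J \<subseteq> {..<N}}"

lemma finite_distinct_lists: "finite (distinct_lists n N)"
  by (rule finite_subset[OF _ finite_lists_length_eq[of "{..<N}" n]])
    (auto simp: distinct_lists_def)

text \<open>The cardinality is a falling factorial with \<open>n\<close> factors between
  \<open>N - n\<close> and \<open>N\<close>; for fixed \<open>n\<close> both bounds are asymptotic
  to \<open>N ^ n\<close>.\<close>

lemma card_distinct_lists_bounds:
  assumes "n \<le> N"
  shows "(N - n) ^ n \<le> card (distinct_lists n N)" "card (distinct_lists n N) \<le> N ^ n"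
proof -
  have "card (distinct_lists n N) = \<Prod>{N - n + 1..N}"
    unfolding distinct_lists_def using card_lists_distinct_length_eq[of "{..<N}" n] assms by simp
  moreover have "(\<Prod>i\<in>{N - n + 1..N}. N - n) \<le> (\<Prod>i\<in>{N - n + 1..N}. i)"
    "(\<Prod>i\<in>{N - n + 1..N}. i) \<le> (\<Prod>i\<in>{N - n + 1..N}. N)"
    by (intro prod_mono; simp)+
  ultimately show "(N - n) ^ n \<le> card (distinct_lists n N)" "card (distinct_lists n N) \<le> N ^ n"
    using assms by simp_all
qed

lemma prod_member:
  fixes a b :: real
  assumes "J \<in> distinct_lists n N"
  shows "(\<Prod>j<N. if j \<in> set J then a else b) = a ^ n * b ^ (N - n)"
proof -
  have J: "set J \<subseteq> {..<N}" "card (set J) = n"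
    using assms by (auto simp: distinct_lists_def distinct_card)
  have "{..<N} \<inter> {j. j \<in> set J} = set J" "{..<N} \<inter> - {j. j \<in> set J} = {..<N} - set J"
    using J by auto
  moreover have "card ({..<N} - set J) = N - n"
    using J by (subst card_Diff_subset) auto
  ultimately show ?thesis
    using J by (simp add: prod.If_cases)
qed

section \<open>Expected number of leaves\<close>

locale poisson_configuration = prob_space M for M :: "'a measure" +
  fixes \<alpha> :: real and \<xi> :: "nat \<Rightarrow> 'a \<Rightarrow> real measure"
  assumes pos: "0 < \<alpha>"
    and poisson: "poisson_point_process \<alpha> (\<xi> k)"
    and indep: "indep_vars (\<lambda>_. point_algebra) \<xi> UNIV"
begin

section \<open>Joint law of the counts in the cells\<close>

abbreviation count :: "nat \<Rightarrow> nat \<Rightarrow> nat \<Rightarrow> 'a \<Rightarrow> ennreal" where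
  "count N k j \<omega> \<equiv> emeasure (\<xi> k \<omega>) (cell N j)"

abbreviation atoms_at :: "'a \<Rightarrow> nat \<Rightarrow> real set" where
  "atoms_at \<omega> k \<equiv> atoms (\<xi> k \<omega>)"

lemma measurable_xi [measurable]: "\<xi> k \<in> M \<rightarrow>\<^sub>M point_algebra"
  using poisson by (simp add: poisson_point_process_def)

lemma point_measure_xi: "\<omega> \<in> space M \<Longrightarrow> point_measure (\<xi> k \<omega>)"
  using measurable_space[OF measurable_xi] by (auto simp: space_point_algebra)

lemma measurable_count [measurable]: "count N k j \<in> borel_measurable M"
  using measurable_compose[OF measurable_xi measurable_emeasure_point_algebra[OF sets_cell]] .

lemma prob_count:
  assumes "j < N"
  shows "prob {\<omega>\<in>space M. count N k j \<omega> = 0} = exp (- (\<alpha> / N))"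
    "prob {\<omega>\<in>space M. count N k j \<omega> = 1} = \<alpha> / N * exp (- (\<alpha> / N))"
    "prob {\<omega>\<in>space M. count N k j \<omega> \<noteq> 0} = 1 - exp (- (\<alpha> / N))"
proof -
  have p: "prob {\<omega>\<in>space M. count N k j \<omega> = of_nat i} =
      (\<alpha> / N) ^ i / fact i * exp (- (\<alpha> / N))" for i
    using poisson[of k] sets_cell[of N j] assms
    by (simp add: poisson_point_process_def measure_cell)
  from p[of 0] show "prob {\<omega>\<in>space M. count N k j \<omega> = 0} = exp (- (\<alpha> / N))" by simp
  then show "prob {\<omega>\<in>space M. count N k j \<omega> \<noteq> 0} = 1 - exp (- (\<alpha> / N))"
    by (subst prob_neg) auto
  from p[of 1] show "prob {\<omega>\<in>space M. count N k j \<omega> = 1} = \<alpha> / N * exp (- (\<alpha> / N))"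
    by simp
qed

lemma prob_counts_level:
  assumes "\<And>j. R j \<in> sets borel"
  shows "prob {\<omega>\<in>space M. \<forall>j<N. count N k j \<omega> \<in> R j} =
    (\<Prod>j<N. prob {\<omega>\<in>space M. count N k j \<omega> \<in> R j})"
\<comment> \<open>The product rule for independent variables asks for a nonempty index set.\<close>
proof (cases "N = 0")
  case False
  have "range (cell N) \<subseteq> sets unit_borel" using sets_cell by blast
  then have "indep_vars (\<lambda>_. borel) (\<lambda>j. count N k j) UNIV"
    using poisson[of k] disjoint_family_cell[of N] unfolding poisson_point_process_def by blast
  then have "indep_vars (\<lambda>_. borel) (\<lambda>j. count N k j) {..<N}"
    by (rule indep_vars_subset) simp
  from indep_varsD_finite[OF this, of R] False assms
  have "prob (\<Inter>j\<in>{..<N}. count N k j -` R j \<inter> space M) =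
      (\<Prod>j<N. prob (count N k j -` R j \<inter> space M))"
    by (auto simp: lessThan_empty_iff)
  moreover have "(\<Inter>j\<in>{..<N}. count N k j -` R j \<inter> space M) =
      {\<omega>\<in>space M. \<forall>j<N. count N k j \<omega> \<in> R j}"
    using False by auto
  moreover have "count N k j -` R j \<inter> space M = {\<omega>\<in>space M. count N k j \<omega> \<in> R j}" for j
    by auto
  ultimately show ?thesis by simp
qed (simp add: prob_space)

text \<open>Two kinds of independence are combined: between processes, and between disjoint cells
  within one process. The product is arranged by cells because each cell is treated according to its
  own level.\<close>

lemma prob_counts:
  fixes n :: nat
  assumes R: "\<And>k j. R k j \<in> sets borel"
  shows "prob {\<omega>\<in>space M. \<forall>k\<le>n. \<forall>j<N. count N k j \<omega> \<in> R k j} =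
    (\<Prod>j<N. \<Prod>k\<le>n. prob {\<omega>\<in>space M. count N k j \<omega> \<in> R k j})"
proof -
  \<comment> \<open>The conditions on all cells are bundled into one event of the random measure, as
    independence of the processes is stated over \<open>point_algebra\<close>.\<close>
  define A where "A k = {\<mu> \<in> space point_algebra. \<forall>j<N. emeasure \<mu> (cell N j) \<in> R k j}" for k
  have A: "A k \<in> sets point_algebra" for k
  proof -
    have [measurable]: "R k j \<in> sets borel" for j by (rule R)
    have [measurable]: "(\<lambda>\<mu>. emeasure \<mu> (cell N j)) \<in> borel_measurable point_algebra" for j
      using measurable_emeasure_point_algebra[OF sets_cell] .
    show ?thesis unfolding A_def by measurable
  qed
  have eq: "\<xi> k -` A k \<inter> space M = {\<omega>\<in>space M. \<forall>j<N. count N k j \<omega> \<in> R k j}" for k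
    using measurable_space[OF measurable_xi] by (auto simp: A_def)
  have "indep_vars (\<lambda>_. point_algebra) \<xi> {..n}"
    using indep by (rule indep_vars_subset) simp
  from indep_varsD_finite[OF this, of A] A
  have "prob (\<Inter>k\<in>{..n}. \<xi> k -` A k \<inter> space M) = (\<Prod>k\<le>n. prob (\<xi> k -` A k \<inter> space M))"
    by auto
  also have "\<dots> = (\<Prod>k\<le>n. \<Prod>j<N. prob {\<omega>\<in>space M. count N k j \<omega> \<in> R k j})"
    unfolding eq using R by (simp add: prob_counts_level)
  also have "\<dots> = (\<Prod>j<N. \<Prod>k\<le>n. prob {\<omega>\<in>space M. count N k j \<omega> \<in> R k j})"
    by (rule prod.swap)
  finally show ?thesis
  proof (rule trans[rotated])
    show "prob {\<omega>\<in>space M. \<forall>k\<le>n. \<forall>j<N. count N k j \<omega> \<in> R k j} =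
        prob (\<Inter>k\<in>{..n}. \<xi> k -` A k \<inter> space M)"
      unfolding eq by (rule arg_cong[of _ _ prob]) auto
  qed
qed

section \<open>Discrete leaves on the grid of cells\<close>

definition cell_ends :: "nat \<Rightarrow> nat \<Rightarrow> 'a \<Rightarrow> nat list set" where
  "cell_ends n N \<omega> = ends (\<lambda>k. cell_index N ` atoms_at \<omega> k) n"

text \<open>A cell of \<open>J\<close> holds one atom in all processes up to index \<open>n\<close>
  together, so atoms cannot be confused there and \<open>J\<close> comes from a true leaf for every
  positive \<open>N\<close>. Other cells are tested once, as in \<open>cell_ends\<close>.\<close>

definition simple_cell_ends :: "nat \<Rightarrow> nat \<Rightarrow> 'a \<Rightarrow> nat list set" where
  "simple_cell_ends n N \<omega> = {J \<in> distinct_lists n N.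
     \<forall>j<N. if j \<in> set J then \<forall>k\<le>n. count N k j \<omega> = (if k = level J j then 1 else 0)
       else count N (level J j) j \<omega> = 0}"

lemma level_le: "J \<in> distinct_lists n N \<Longrightarrow> level J j \<le> n"
  using level_le_length[of J j] by (simp add: distinct_lists_def)

text \<open>Reduces membership to finitely many counts: indices from \<open>N\<close> on are neither
  entries of \<open>J\<close> nor occupied.\<close>

lemma cell_ends_eq:
  assumes \<omega>: "\<omega> \<in> space M" and "0 < N"
  shows "cell_ends n N \<omega> = {J \<in> distinct_lists n N.
     \<forall>j<N. j \<in> set J \<longleftrightarrow> count N (level J j) j \<omega> \<noteq> 0}"
proof -
  note pm = point_measure_xi[OF \<omega>]
  have less: "j < N" if "j \<in> cell_index N ` atoms_at \<omega> k" for j k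
    using that cell_index_less[OF \<open>0 < N\<close>] point_measureD(2)[OF pm] by (auto simp: atoms_def)
  show ?thesis
  proof (intro set_eqI iffI)
    fix J assume J: "J \<in> cell_ends n N \<omega>"
    then have "j < N" if "j \<in> set J" for j
      using that less[of j "level J j"] by (simp add: cell_ends_def ends_def)
    with J show "J \<in> {J \<in> distinct_lists n N. \<forall>j<N. j \<in> set J \<longleftrightarrow> count N (level J j) j \<omega> \<noteq> 0}"
      by (simp add: cell_ends_def ends_def distinct_lists_def cell_index_atoms_iff[OF pm] subset_iff)
  next
    fix J assume J: "J \<in> {J \<in> distinct_lists n N. \<forall>j<N. j \<in> set J \<longleftrightarrow> count N (level J j) j \<omega> \<noteq> 0}"
    have "j \<in> set J \<longleftrightarrow> j \<in> cell_index N ` atoms_at \<omega> (level J j)" for j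
    proof (cases "j < N")
      case True
      then show ?thesis using J unfolding cell_index_atoms_iff[OF pm] by blast
    next
      case False
      moreover have "set J \<subseteq> {..<N}" using J by (simp add: distinct_lists_def)
      ultimately show ?thesis using less[of j "level J j"] by blast
    qed
    with J show "J \<in> cell_ends n N \<omega>"
      by (simp add: cell_ends_def ends_def distinct_lists_def)
  qed
qed

lemma simple_cell_ends_lift:
  assumes \<omega>: "\<omega> \<in> space M" and "0 < N"
  shows "simple_cell_ends n N \<omega> \<subseteq> map (cell_index N) ` ends (atoms_at \<omega>) n"
proof
  fix J assume J: "J \<in> simple_cell_ends n N \<omega>"
  note pm = point_measure_xi[OF \<omega>]
  have D: "J \<in> distinct_lists n N" using J by (simp add: simple_cell_ends_def)
  have c: "count N k j \<omega> = (if k = level J j then 1 else 0)" if "j \<in> set J" "k \<le> n" for k j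
    using J that by (auto simp: simple_cell_ends_def distinct_lists_def)
  \<comment> \<open>An atom in a cell of \<open>J\<close> makes the count nonzero there, which is
    permitted only in the process of the level of that cell.\<close>
  have only: "k = level J (cell_index N x)"
    if "x \<in> atoms_at \<omega> k" "cell_index N x \<in> set J" "k \<le> n" for x k
    using c[OF that(2,3)] cell_index_atoms_iff[OF pm, of "cell_index N x" N k] that(1)
    by (auto split: if_splits)
  have "J \<in> cell_ends n N \<omega>"
    unfolding cell_ends_eq[OF assms]
  proof (intro CollectI conjI D allI impI)
    fix j assume "j < N"
    then show "j \<in> set J \<longleftrightarrow> count N (level J j) j \<omega> \<noteq> 0"
      using J c[OF _ level_le[OF D]] by (cases "j \<in> set J") (auto simp: simple_cell_ends_def)
  qed
  then show "J \<in> map (cell_index N) ` ends (atoms_at \<omega>) n"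
    unfolding cell_ends_def
  proof (rule ends_lift[OF mono_cell_index])
    fix x y assume xy: "x \<in> (\<Union>k\<le>n. atoms_at \<omega> k)" "y \<in> (\<Union>k\<le>n. atoms_at \<omega> k)"
      "cell_index N x \<in> set J" "cell_index N x = cell_index N y"
    then obtain k l where "x \<in> atoms_at \<omega> k" "k \<le> n" "y \<in> atoms_at \<omega> l" "l \<le> n" by blast
    with xy only[of x k] only[of y l]
    have "x \<in> atoms_at \<omega> (level J (cell_index N x))" "y \<in> atoms_at \<omega> (level J (cell_index N x))"
      by simp_all
    then show "x = y"
      using xy c[OF xy(3) level_le[OF D]] by (intro atoms_cell_unique[OF pm]) auto
  qed
qed

lemma finite_ends_atoms: "\<omega> \<in> space M \<Longrightarrow> finite (ends (atoms_at \<omega>) n)"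
  by (intro finite_ends finite_atoms point_measure_xi)

lemma card_simple_cell_ends_le:
  assumes "\<omega> \<in> space M" "0 < N"
  shows "card (simple_cell_ends n N \<omega>) \<le> card (ends (atoms_at \<omega>) n)"
  by (rule surj_card_le[OF finite_ends_atoms[OF assms(1)] simple_cell_ends_lift[OF assms]])

text \<open>For a fixed outcome only finitely many atoms occur up to index \<open>n\<close>; once
  the cells separate them, \<open>map (cell_index N)\<close> is a bijection from leaves to discrete
  leaves. How large \<open>N\<close> must be depends on \<open>\<omega>\<close>, hence the later use
  of Fatou's lemma.\<close>

lemma eventually_card_cell_ends:
  assumes \<omega>: "\<omega> \<in> space M"
  shows "\<forall>\<^sub>F N in sequentially. card (cell_ends n N \<omega>) = card (ends (atoms_at \<omega>) n)"
proof -
  let ?A = "\<Union>k\<le>n. atoms_at \<omega> k"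
  note pm = point_measure_xi[OF \<omega>]
  have "?A \<subseteq> {0..}"
    using point_measureD(2)[OF pm] by (auto simp: atoms_def)
  then have "\<forall>\<^sub>F N in sequentially. inj_on (cell_index N) ?A"
    using finite_atoms[OF pm] by (intro eventually_inj_on_cell_index) auto
  then show ?thesis
  proof (rule eventually_mono)
    fix N assume inj: "inj_on (cell_index N) ?A"
    let ?f = "map (cell_index N)"
    have "?f ` ends (atoms_at \<omega>) n \<subseteq> cell_ends n N \<omega>"
      unfolding cell_ends_def using map_in_ends[OF mono_cell_index inj] by blast
    moreover have "J \<in> ?f ` ends (atoms_at \<omega>) n" if "J \<in> cell_ends n N \<omega>" for J
      using that inj unfolding cell_ends_def
      by (intro ends_lift[OF mono_cell_index]) (auto dest: inj_onD)
    ultimately have "cell_ends n N \<omega> = ?f ` ends (atoms_at \<omega>) n" by blast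
    moreover have "inj_on ?f (ends (atoms_at \<omega>) n)"
    proof (rule inj_onI)
      fix v w assume vw: "v \<in> ends (atoms_at \<omega>) n" "w \<in> ends (atoms_at \<omega>) n" "?f v = ?f w"
      then have "set v \<union> set w \<subseteq> ?A" using ends_subset by blast
      then show "v = w" using vw(3) inj_on_subset[OF inj] map_inj_on by metis
    qed
    ultimately show "card (cell_ends n N \<omega>) = card (ends (atoms_at \<omega>) n)"
      by (simp add: card_image)
  qed
qed

text \<open>Every cell is tested in the one process given by its level: the \<open>n\<close> cells
  of \<open>J\<close> must be occupied there, the other \<open>N - n\<close> empty.\<close>

lemma prob_mem_cell_ends:
  assumes J: "J \<in> distinct_lists n N" and "0 < N"
  shows "prob {\<omega>\<in>space M. J \<in> cell_ends n N \<omega>} =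
    (1 - exp (- (\<alpha> / N))) ^ n * exp (- (\<alpha> / N)) ^ (N - n)"
proof -
  \<comment> \<open>\<open>UNIV\<close> imposes no condition and contributes the factor 1, so a
    single factor per cell survives.\<close>
  define R :: "nat \<Rightarrow> nat \<Rightarrow> ennreal set" where
    "R k j = (if k = level J j then if j \<in> set J then - {0} else {0} else UNIV)" for k j
  have "J \<in> cell_ends n N \<omega> \<longleftrightarrow> (\<forall>k\<le>n. \<forall>j<N. count N k j \<omega> \<in> R k j)" if "\<omega> \<in> space M" for \<omega>
    unfolding cell_ends_eq[OF that \<open>0 < N\<close>] using J level_le[OF J]
    by (auto simp: R_def split: if_splits)
  then have "prob {\<omega>\<in>space M. J \<in> cell_ends n N \<omega>} =
      prob {\<omega>\<in>space M. \<forall>k\<le>n. \<forall>j<N. count N k j \<omega> \<in> R k j}"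
    by (metis (no_types, lifting) Collect_cong)
  also have "\<dots> = (\<Prod>j<N. \<Prod>k\<le>n. prob {\<omega>\<in>space M. count N k j \<omega> \<in> R k j})"
    by (rule prob_counts) (simp add: R_def)
  also have "\<dots> = (\<Prod>j<N. if j \<in> set J then 1 - exp (- (\<alpha> / N)) else exp (- (\<alpha> / N)))"
  proof (rule prod.cong[OF refl])
    fix j assume "j \<in> {..<N}"
    then have "j < N" by simp
    have "(\<Prod>k\<le>n. prob {\<omega>\<in>space M. count N k j \<omega> \<in> R k j}) =
        (\<Prod>k\<le>n. if k = level J j then
           if j \<in> set J then 1 - exp (- (\<alpha> / N)) else exp (- (\<alpha> / N)) else 1)"
      by (rule prod.cong) (simp_all add: R_def prob_count[OF \<open>j < N\<close>] prob_space)
    also have "\<dots> = (if j \<in> set J then 1 - exp (- (\<alpha> / N)) else exp (- (\<alpha> / N)))"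
      using level_le[OF J, of j] by (simp add: prod.delta)
    finally show "(\<Prod>k\<le>n. prob {\<omega>\<in>space M. count N k j \<omega> \<in> R k j}) = \<dots>" .
  qed
  also have "\<dots> = (1 - exp (- (\<alpha> / N))) ^ n * exp (- (\<alpha> / N)) ^ (N - n)"
    by (rule prod_member[OF J])
  finally show ?thesis .
qed

text \<open>In a cell of \<open>J\<close>, one atom at its level has probability
  \<open>\<alpha> / N * exp (- (\<alpha> / N))\<close>, and absence from each of the other
  \<open>n\<close> processes gives a further \<open>exp (- (\<alpha> / N))\<close>; hence the
  exponent \<open>n + 1\<close>.\<close>

lemma prob_mem_simple_cell_ends:
  assumes J: "J \<in> distinct_lists n N"
  shows "prob {\<omega>\<in>space M. J \<in> simple_cell_ends n N \<omega>} =
    (\<alpha> / N * exp (- (\<alpha> / N)) ^ (n + 1)) ^ n * exp (- (\<alpha> / N)) ^ (N - n)"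
proof -
  define R :: "nat \<Rightarrow> nat \<Rightarrow> ennreal set" where
    "R k j = (if j \<in> set J then if k = level J j then {1} else {0}
       else if k = level J j then {0} else UNIV)" for k j
  have "J \<in> simple_cell_ends n N \<omega> \<longleftrightarrow> (\<forall>k\<le>n. \<forall>j<N. count N k j \<omega> \<in> R k j)" for \<omega>
    using J level_le[OF J] by (auto simp: simple_cell_ends_def R_def split: if_splits)
  then have "prob {\<omega>\<in>space M. J \<in> simple_cell_ends n N \<omega>} =
      prob {\<omega>\<in>space M. \<forall>k\<le>n. \<forall>j<N. count N k j \<omega> \<in> R k j}"
    by simp
  also have "\<dots> = (\<Prod>j<N. \<Prod>k\<le>n. prob {\<omega>\<in>space M. count N k j \<omega> \<in> R k j})"
    by (rule prob_counts) (simp add: R_def)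
  also have "\<dots> = (\<Prod>j<N. if j \<in> set J then \<alpha> / N * exp (- (\<alpha> / N)) ^ (n + 1) else exp (- (\<alpha> / N)))"
  proof (rule prod.cong[OF refl])
    fix j assume "j \<in> {..<N}"
    then have "j < N" by simp
    \<comment> \<open>Each factor is split into a part present only at the level and a part common
      to all \<open>n + 1\<close> indices, so that the product over \<open>k\<close>
      separates.\<close>
    have "(\<Prod>k\<le>n. prob {\<omega>\<in>space M. count N k j \<omega> \<in> R k j}) =
        (\<Prod>k\<le>n. (if k = level J j then if j \<in> set J then \<alpha> / N else exp (- (\<alpha> / N)) else 1) *
           (if j \<in> set J then exp (- (\<alpha> / N)) else 1))"
      by (rule prod.cong) (simp_all add: R_def prob_count[OF \<open>j < N\<close>] prob_space)
    also have "\<dots> = (if j \<in> set J then \<alpha> / N * exp (- (\<alpha> / N)) ^ (n + 1) else exp (- (\<alpha> / N)))"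
      using level_le[OF J, of j] by (simp add: prod.distrib prod.delta)
    finally show "(\<Prod>k\<le>n. prob {\<omega>\<in>space M. count N k j \<omega> \<in> R k j}) = \<dots>" .
  qed
  also have "\<dots> = (\<alpha> / N * exp (- (\<alpha> / N)) ^ (n + 1)) ^ n * exp (- (\<alpha> / N)) ^ (N - n)"
    by (rule prod_member[OF J])
  finally show ?thesis .
qed

text \<open>Linearity of expectation, with the cardinality written as a sum of indicators over the
  fixed finite set \<open>D\<close>.\<close>

lemma card_random_subset:
  fixes p :: real
  assumes "finite D" and B: "\<And>\<omega>. \<omega> \<in> space M \<Longrightarrow> B \<omega> \<subseteq> D"
    and ev: "\<And>J. J \<in> D \<Longrightarrow> {\<omega>\<in>space M. J \<in> B \<omega>} \<in> events"
    and p: "\<And>J. J \<in> D \<Longrightarrow> prob {\<omega>\<in>space M. J \<in> B \<omega>} = p"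
  shows "(\<lambda>\<omega>. of_nat (card (B \<omega>)) :: ennreal) \<in> borel_measurable M"
    and "(\<integral>\<^sup>+\<omega>. of_nat (card (B \<omega>)) \<partial>M) = ennreal (card D * p)"
proof -
  have eq: "of_nat (card (B \<omega>)) = (\<Sum>J\<in>D. indicator {\<omega>\<in>space M. J \<in> B \<omega>} \<omega> :: ennreal)"
    if "\<omega> \<in> space M" for \<omega>
  proof -
    have "(\<Sum>J\<in>D. indicator {\<omega>\<in>space M. J \<in> B \<omega>} \<omega> :: ennreal) = (\<Sum>J\<in>D. if J \<in> B \<omega> then 1 else 0)"
      using that by (intro sum.cong) auto
    also have "\<dots> = of_nat (card (D \<inter> B \<omega>))"
      using \<open>finite D\<close> by (simp add: sum.If_cases)
    also have "D \<inter> B \<omega> = B \<omega>" using B[OF that] by blast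
    finally show ?thesis by simp
  qed
  have m: "(\<lambda>\<omega>. \<Sum>J\<in>D. indicator {\<omega>\<in>space M. J \<in> B \<omega>} \<omega> :: ennreal) \<in> borel_measurable M"
    by (intro borel_measurable_sum borel_measurable_indicator ev)
  then show "(\<lambda>\<omega>. of_nat (card (B \<omega>)) :: ennreal) \<in> borel_measurable M"
    by (subst measurable_cong[OF eq])
  have "(\<integral>\<^sup>+\<omega>. of_nat (card (B \<omega>)) \<partial>M) =
      (\<integral>\<^sup>+\<omega>. (\<Sum>J\<in>D. indicator {\<omega>\<in>space M. J \<in> B \<omega>} \<omega>) \<partial>M)"
    by (rule nn_integral_cong) (rule eq)
  also have "\<dots> = (\<Sum>J\<in>D. \<integral>\<^sup>+\<omega>. indicator {\<omega>\<in>space M. J \<in> B \<omega>} \<omega> \<partial>M)"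
    by (intro nn_integral_sum borel_measurable_indicator ev)
  also have "\<dots> = (\<Sum>J\<in>D. ennreal p)"
    by (intro sum.cong refl) (simp add: nn_integral_indicator ev emeasure_eq_measure p)
  also have "\<dots> = ennreal (card D * p)"
    by (simp add: ennreal_of_nat_eq_real_of_nat ennreal_mult')
  finally show "(\<integral>\<^sup>+\<omega>. of_nat (card (B \<omega>)) \<partial>M) = ennreal (card D * p)" .
qed

lemma card_cell_ends:
  assumes "0 < N"
  shows "(\<lambda>\<omega>. of_nat (card (cell_ends n N \<omega>)) :: ennreal) \<in> borel_measurable M" (is ?m)
    and "(\<integral>\<^sup>+\<omega>. of_nat (card (cell_ends n N \<omega>)) \<partial>M) = ennreal (card (distinct_lists n N) *
      ((1 - exp (- (\<alpha> / N))) ^ n * exp (- (\<alpha> / N)) ^ (N - n)))" (is ?i)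
proof -
  have sub: "cell_ends n N \<omega> \<subseteq> distinct_lists n N" if "\<omega> \<in> space M" for \<omega>
    using cell_ends_eq[OF that assms] by blast
  have ev: "{\<omega>\<in>space M. J \<in> cell_ends n N \<omega>} \<in> events" if "J \<in> distinct_lists n N" for J
  proof -
    have "{\<omega>\<in>space M. J \<in> cell_ends n N \<omega>} =
        {\<omega>\<in>space M. \<forall>j<N. j \<in> set J \<longleftrightarrow> count N (level J j) j \<omega> \<noteq> 0}"
      using that cell_ends_eq[OF _ assms] by blast
    also have "\<dots> \<in> events" by measurable
    finally show ?thesis .
  qed
  note * = card_random_subset[OF finite_distinct_lists sub ev prob_mem_cell_ends[OF _ assms]]
  show ?m ?i by (rule *; assumption)+
qed

lemma card_simple_cell_ends:
  "(\<integral>\<^sup>+\<omega>. of_nat (card (simple_cell_ends n N \<omega>)) \<partial>M) = ennreal (card (distinct_lists n N) *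
    ((\<alpha> / N * exp (- (\<alpha> / N)) ^ (n + 1)) ^ n * exp (- (\<alpha> / N)) ^ (N - n)))"
proof (rule card_random_subset(2)[OF finite_distinct_lists])
  show "simple_cell_ends n N \<omega> \<subseteq> distinct_lists n N" for \<omega>
    by (auto simp: simple_cell_ends_def)
  show "{\<omega>\<in>space M. J \<in> simple_cell_ends n N \<omega>} \<in> events" if "J \<in> distinct_lists n N" for J
    unfolding simple_cell_ends_def by measurable
qed (rule prob_mem_simple_cell_ends)

section \<open>Limit of the expectations as the cells shrink\<close>

lemma exp_power_limit:
  "(\<lambda>N. exp (- (\<alpha> / real N)) ^ (N - n)) \<longlonglongrightarrow> exp (- \<alpha>)"
proof -
  have "(\<lambda>N. exp (\<alpha> * (real n / real N) - \<alpha>)) \<longlonglongrightarrow> exp (\<alpha> * 0 - \<alpha>)"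
    by (intro tendsto_intros lim_const_over_n)
  moreover have "\<forall>\<^sub>F N in sequentially.
      exp (\<alpha> * (real n / real N) - \<alpha>) = exp (- (\<alpha> / real N)) ^ (N - n)"
    \<comment> \<open>From \<open>Suc n\<close> on, \<open>N - n\<close> is a true difference and
      \<open>N\<close> is nonzero.\<close>
    using eventually_ge_at_top[of "Suc n"]
  proof (rule eventually_mono)
    fix N assume "Suc n \<le> N"
    then show "exp (\<alpha> * (real n / real N) - \<alpha>) = exp (- (\<alpha> / real N)) ^ (N - n)"
      by (simp add: exp_of_nat_mult[symmetric] of_nat_diff field_simps)
  qed
  ultimately show ?thesis by (simp add: Lim_transform_eventually)
qed

text \<open>A pointwise limit of the measurable discrete counts; \<open>Suc N\<close> keeps the
  number of cells positive.\<close>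

lemma measurable_card_ends:
  "(\<lambda>\<omega>. of_nat (card (ends (atoms_at \<omega>) n)) :: ennreal) \<in> borel_measurable M"
proof (rule borel_measurable_LIMSEQ_order)
  show "(\<lambda>\<omega>. of_nat (card (cell_ends n (Suc N) \<omega>)) :: ennreal) \<in> borel_measurable M" for N
    by (rule card_cell_ends) simp
  fix \<omega> assume "\<omega> \<in> space M"
  then show "(\<lambda>N. of_nat (card (cell_ends n (Suc N) \<omega>)) :: ennreal)
      \<longlonglongrightarrow> of_nat (card (ends (atoms_at \<omega>) n))"
    by (intro LIMSEQ_Suc tendsto_eventually) (auto intro: eventually_mono[OF eventually_card_cell_ends])
qed

lemma nn_integral_ends_le:
  "(\<integral>\<^sup>+\<omega>. of_nat (card (ends (atoms_at \<omega>) n)) \<partial>M) \<le> ennreal (\<alpha> ^ n * exp (- \<alpha>))"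
proof -
  let ?X = "\<lambda>N \<omega>. of_nat (card (cell_ends n (Suc N) \<omega>)) :: ennreal"
  let ?u = "\<lambda>N. \<alpha> ^ n * exp (- (\<alpha> / real N)) ^ (N - n)"
  have "(\<integral>\<^sup>+\<omega>. of_nat (card (ends (atoms_at \<omega>) n)) \<partial>M) = (\<integral>\<^sup>+\<omega>. liminf (\<lambda>N. ?X N \<omega>) \<partial>M)"
  proof (rule nn_integral_cong)
    fix \<omega> assume "\<omega> \<in> space M"
    then have "(\<lambda>N. ?X N \<omega>) \<longlonglongrightarrow> of_nat (card (ends (atoms_at \<omega>) n))"
      by (intro LIMSEQ_Suc tendsto_eventually) (auto intro: eventually_mono[OF eventually_card_cell_ends])
    then show "of_nat (card (ends (atoms_at \<omega>) n)) = liminf (\<lambda>N. ?X N \<omega>)"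
      by (simp add: lim_imp_Liminf)
  qed
  also have "\<dots> \<le> liminf (\<lambda>N. \<integral>\<^sup>+\<omega>. ?X N \<omega> \<partial>M)"
    by (intro nn_integral_liminf card_cell_ends) simp
  also have "\<dots> \<le> liminf (\<lambda>N. ennreal (?u (Suc N)))"
  proof (rule Liminf_mono)
    show "\<forall>\<^sub>F N in sequentially. (\<integral>\<^sup>+\<omega>. ?X N \<omega> \<partial>M) \<le> ennreal (?u (Suc N))"
      using eventually_ge_at_top[of n]
    proof (rule eventually_mono)
      fix N assume "n \<le> N"
      let ?N = "Suc N"
      let ?q = "1 - exp (- (\<alpha> / ?N))"
      \<comment> \<open>The inequality \<open>1 - exp (- x) \<le> x\<close> bounds the occupation
        probability by \<open>\<alpha> / ?N\<close>; the power \<open>?N ^ n\<close> in its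
        denominator then cancels against the bound on the number of lists.\<close>
      have q: "0 \<le> ?q" "?q \<le> \<alpha> / ?N"
        using pos exp_ge_add_one_self[of "- (\<alpha> / ?N)"] by simp_all
      have card: "real (card (distinct_lists n ?N)) \<le> real ?N ^ n"
        using card_distinct_lists_bounds(2)[of n ?N] \<open>n \<le> N\<close>
        by (simp only: of_nat_le_iff flip: of_nat_power)
      have "real (card (distinct_lists n ?N)) * (?q ^ n * exp (- (\<alpha> / ?N)) ^ (?N - n))
          \<le> real ?N ^ n * ((\<alpha> / ?N) ^ n * exp (- (\<alpha> / ?N)) ^ (?N - n))"
        using card q by (intro mult_mono power_mono) simp_all
      also have "\<dots> = ?u ?N"
        by (simp add: power_divide)
      finally show "(\<integral>\<^sup>+\<omega>. ?X N \<omega> \<partial>M) \<le> ennreal (?u (Suc N))"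
        by (simp only: card_cell_ends(2)[OF zero_less_Suc] ennreal_leI)
    qed
  qed
  also have "\<dots> = ennreal (\<alpha> ^ n * exp (- \<alpha>))"
  proof (rule lim_imp_Liminf)
    show "(\<lambda>N. ennreal (?u (Suc N))) \<longlonglongrightarrow> ennreal (\<alpha> ^ n * exp (- \<alpha>))"
      by (intro tendsto_ennrealI tendsto_mult_left LIMSEQ_Suc[OF exp_power_limit])
  qed simp
  finally show ?thesis .
qed

text \<open>Simple discrete leaves lift for every positive \<open>N\<close> and every outcome, so
  each of their expectations is a lower bound outright and no limit has to pass through the
  integral.\<close>

lemma nn_integral_ends_ge:
  "ennreal (\<alpha> ^ n * exp (- \<alpha>)) \<le> (\<integral>\<^sup>+\<omega>. of_nat (card (ends (atoms_at \<omega>) n)) \<partial>M)"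
proof (rule tendsto_upperbound)
  \<comment> \<open>\<open>(N - n) ^ n\<close> replaces the number of lists and is merged with the
    \<open>n\<close> factors \<open>1 / N\<close>, so that every piece has a limit.\<close>
  let ?l = "\<lambda>N. ((1 - real n / real N) * \<alpha> * exp (- (\<alpha> / real N)) ^ (n + 1)) ^ n *
    exp (- (\<alpha> / real N)) ^ (N - n)"
  have "?l \<longlonglongrightarrow> ((1 - 0) * \<alpha> * exp (- 0) ^ (n + 1)) ^ n * exp (- \<alpha>)"
    by (intro tendsto_intros exp_power_limit lim_const_over_n)
  then show "(\<lambda>N. ennreal (?l N)) \<longlonglongrightarrow> ennreal (\<alpha> ^ n * exp (- \<alpha>))"
    by (intro tendsto_ennrealI) simp
  show "\<forall>\<^sub>F N in sequentially. ennreal (?l N) \<le> (\<integral>\<^sup>+\<omega>. of_nat (card (ends (atoms_at \<omega>) n)) \<partial>M)"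
    using eventually_ge_at_top[of "Suc n"]
  proof (rule eventually_mono)
    fix N assume N: "Suc n \<le> N"
    let ?e = "exp (- (\<alpha> / N))"
    have "?l N = real ((N - n) ^ n) * ((\<alpha> / N * ?e ^ (n + 1)) ^ n * ?e ^ (N - n))"
    proof -
      have "(1 - real n / real N) * \<alpha> * ?e ^ (n + 1) = real (N - n) * (\<alpha> / N * ?e ^ (n + 1))"
        using N by (simp add: of_nat_diff field_simps)
      then show ?thesis by (simp only: power_mult_distrib of_nat_power mult.assoc)
    qed
    also have "\<dots> \<le> real (card (distinct_lists n N)) * ((\<alpha> / N * ?e ^ (n + 1)) ^ n * ?e ^ (N - n))"
      using card_distinct_lists_bounds(1)[of n N] N pos
      by (intro mult_right_mono of_nat_mono) auto
    finally have "ennreal (?l N) \<le> (\<integral>\<^sup>+\<omega>. of_nat (card (simple_cell_ends n N \<omega>)) \<partial>M)"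
      unfolding card_simple_cell_ends by (rule ennreal_leI)
    also have "\<dots> \<le> (\<integral>\<^sup>+\<omega>. of_nat (card (ends (atoms_at \<omega>) n)) \<partial>M)"
      using N card_simple_cell_ends_le by (intro nn_integral_mono) simp
    finally show "ennreal (?l N) \<le> (\<integral>\<^sup>+\<omega>. of_nat (card (ends (atoms_at \<omega>) n)) \<partial>M)" .
  qed
qed simp

section \<open>Summation over the depth\<close>

lemma num_leaves_eq_suminf:
  assumes "\<omega> \<in> space M"
  shows "num_leaves (\<lambda>k. \<xi> k \<omega>) = (\<Sum>n. of_nat (card (ends (atoms_at \<omega>) n)))"
  unfolding num_leaves_eq[OF point_measure_xi[OF assms]]
  using finite_ends_atoms[OF assms] by (simp add: emeasure_count_space_finite)

lemma measurable_num_leaves: "(\<lambda>\<omega>. num_leaves (\<lambda>k. \<xi> k \<omega>)) \<in> borel_measurable M"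
  using measurable_card_ends by (subst measurable_cong[OF num_leaves_eq_suminf]) (auto intro: borel_measurable_suminf_order)

text \<open>Nonnegativity allows the sum over depths to leave the integral; the upper and lower
  bounds then pin down each term.\<close>

lemma nn_integral_num_leaves:
  "(\<integral>\<^sup>+\<omega>. num_leaves (\<lambda>k. \<xi> k \<omega>) \<partial>M) = (\<Sum>n. ennreal (\<alpha> ^ n * exp (- \<alpha>)))"
proof -
  have "(\<integral>\<^sup>+\<omega>. num_leaves (\<lambda>k. \<xi> k \<omega>) \<partial>M) =
      (\<integral>\<^sup>+\<omega>. (\<Sum>n. of_nat (card (ends (atoms_at \<omega>) n))) \<partial>M)"
    by (rule nn_integral_cong) (rule num_leaves_eq_suminf)
  also have "\<dots> = (\<Sum>n. \<integral>\<^sup>+\<omega>. of_nat (card (ends (atoms_at \<omega>) n)) \<partial>M)"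
    by (rule nn_integral_suminf) (rule measurable_card_ends)
  also have "\<dots> = (\<Sum>n. ennreal (\<alpha> ^ n * exp (- \<alpha>)))"
    using nn_integral_ends_le nn_integral_ends_ge by (intro suminf_cong antisym)
  finally show ?thesis .
qed

end

theorem theorem2:
  fixes M :: "'a measure" and \<xi> :: "nat \<Rightarrow> 'a \<Rightarrow> real measure"
    and U :: "'a \<Rightarrow> ennreal" and \<alpha> :: real
  assumes "prob_space M"
    and "0 < \<alpha>" and "\<alpha> \<le> 1"
    and "\<And>k. prob_space.poisson_point_process M \<alpha> (\<xi> k)"
    and "prob_space.indep_vars M (\<lambda>_. point_algebra) \<xi> UNIV"
    and "U = (\<lambda>\<omega>. num_leaves (\<lambda>k. \<xi> k \<omega>))"
  shows "U \<in> borel_measurable M \<and>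
    (\<alpha> < 1 \<longrightarrow> (\<integral>\<^sup>+\<omega>. U \<omega> \<partial>M) = ennreal (exp (- \<alpha>) / (1 - \<alpha>))) \<and>
    (\<alpha> = 1 \<longrightarrow> (\<integral>\<^sup>+\<omega>. U \<omega> \<partial>M) = \<infinity>)"
proof -
  interpret poisson_configuration M \<alpha> \<xi>
    using assms by (simp add: poisson_configuration_def poisson_configuration_axioms_def)
  have int: "(\<integral>\<^sup>+\<omega>. U \<omega> \<partial>M) = (\<Sum>n. ennreal (\<alpha> ^ n * exp (- \<alpha>)))"
    unfolding assms(6) by (rule nn_integral_num_leaves)
  have "(\<integral>\<^sup>+\<omega>. U \<omega> \<partial>M) = ennreal (exp (- \<alpha>) / (1 - \<alpha>))" if "\<alpha> < 1"
  proof -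
    have "(\<lambda>n. \<alpha> ^ n * exp (- \<alpha>)) sums (1 / (1 - \<alpha>) * exp (- \<alpha>))"
      using that assms(2) by (intro sums_mult2 geometric_sums) simp
    then have "(\<Sum>n. ennreal (\<alpha> ^ n * exp (- \<alpha>))) = ennreal (1 / (1 - \<alpha>) * exp (- \<alpha>))"
      using assms(2) by (intro suminf_ennreal_eq) simp_all
    then show ?thesis unfolding int by simp
  qed
  moreover have "(\<integral>\<^sup>+\<omega>. U \<omega> \<partial>M) = \<infinity>" if "\<alpha> = 1"
  proof -
    have "(\<Sum>n. ennreal (\<alpha> ^ n * exp (- \<alpha>))) = \<infinity>"
    proof (rule ccontr)
      assume "\<not> ?thesis"
      \<comment> \<open>For \<open>\<alpha> = 1\<close> every depth contributes
        \<open>exp (- 1)\<close>; a finite total would make this nonzero constant sequence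
        summable.\<close>
      then have "summable (\<lambda>n. \<alpha> ^ n * exp (- \<alpha>))"
        using assms(2) by (intro summable_suminf_not_top) (simp_all add: top.not_eq_extremum)
      then show False using that by (simp add: summable_const_iff)
    qed
    then show ?thesis unfolding int .
  qed
  moreover have "U \<in> borel_measurable M"
    unfolding assms(6) by (rule measurable_num_leaves)
  ultimately show ?thesis by blast
qed

end
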